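(* Let $X$ be an abelian surface and let $v=(r,c_1,a)\in H^*(X,\mathbb{Z})_{\mathrm{alg}}$ be a Mukai vector with $\langle v^2\rangle>0$. For $(\beta,H,t)\in\overline{\mathfrak H}$ put $$\xi(\beta,H,t):=\Big(r\tfrac{t^2(H^2)}{2}+\langle e^\beta,v\rangle\Big)\big(H+(\beta,H)\varrho_X\big)-(c_1-r\beta,H)\Big(e^\beta-\tfrac{t^2(H^2)}{2}\varrho_X\Big).$$ Then $\xi(\beta,H,t)\in\overline{P^+(v^\perp)}_{\mathbb R}$ for every $(\beta,H,t)\in\overline{\mathfrak H}$, and the map $$\Xi:\overline{\mathfrak H}\to\overline{P^+(v^\perp)}_{\mathbb R}/\mathbb{R}_{>0},\qquad (\beta,H,t)\mapsto\mathbb{R}_{>0}\,\xi(\beta,H,t)$$ is surjective. Moreover, if $tH$ is ample, then $\xi(\beta,H,t)$ belongs to the positive cone $P^+(v^\perp)_{\mathbb R}$ of $v^\perp$.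
   Context: $X$ is an abelian surface over $\mathbb{C}$ and $\varrho_X\in H^4(X,\mathbb Z)$ is the fundamental class. $H^*(X,\mathbb{Z})_{\mathrm{alg}}:=\mathbb{Z}\oplus\mathrm{NS}(X)\oplus\mathbb{Z}\varrho_X$; its elements are called Mukai vectors and are written $x=(x_0,x_1,x_2)=x_0+x_1+x_2\varrho_X$. The Mukai pairing is $\langle x,y\rangle=(x_1,y_1)-x_0y_2-x_2y_0$, and $\langle x^2\rangle:=\langle x,x\rangle$; it is extended to real coefficients. $e^\beta=(1,\beta,(\beta^2)/2)$ for $\beta\in\mathrm{NS}(X)_{\mathbb R}$. $v^\perp$ is the orthogonal complement of $v$. $\overline{\mathrm{Amp}(X)}_{\mathbb R}:=\{x\in\mathrm{NS}(X)_{\mathbb R}\mid (x^2)\ge 0,\ (x,h)>0\}$ where $h$ is an ample class. Fix a norm $\|\cdot\|$ on $\mathrm{NS}(X)_{\mathbb R}$ and put $C(\overline{\mathrm{Amp}(X)}_{\mathbb R}):=\{x\in\overline{\mathrm{Amp}(X)}_{\mathbb R}\mid \|x\|=1\}$ and $\overline{\mathfrak H}:=\mathrm{NS}(X)_{\mathbb R}\times C(\overline{\mathrm{Amp}(X)}_{\mathbb R})\times\mathbb{R}_{\ge 0}$. Fix an ample divisor $H_0$ on $X$. Then $$\overline{P^+(v^\perp)}_{\mathbb R}:=\{x\in H^*(X,\mathbb{Z})_{\mathrm{alg}}\otimes\mathbb{R}\mid x\in v^\perp,\ \langle x^2\rangle\ge 0,\ \langle x,rH_0+(H_0,c_1)\varrho_X\rangle>0\},$$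 and $P^+(v^\perp)_{\mathbb R}$ is the subset where $\langle x^2\rangle>0$. *)

theory Defs
  imports "HOL-Analysis.Analysis"
begin

text \<open>
  An abelian surface over the complex numbers is treated analytically, as a two-dimensional
  complex torus \<open>X = V / \<Lambda>\<close>, \<open>V = \<complex>\<^sup>2\<close>, with \<open>\<Lambda>\<close> a lattice of rank 4, that carries an ample class.
  Then \<open>H\<^sup>2(X,\<int>)\<close> is the group of alternating forms on \<open>\<Lambda>\<close> with integer values, cup product is the
  wedge product of forms, and by the theorem of Appell and Humbert (equivalently Lefschetz (1,1))
  \<open>NS(X)\<close> consists of the forms whose real extension to \<open>V\<close> is invariant under multiplication by
  \<open>\<i>\<close>. A class is represented by that real extension.
\<close>

type_synonym form = "(complex ^ 2) \<Rightarrow>\<^sub>L (complex ^ 2) \<Rightarrow>\<^sub>L real"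

definition lattice_basis :: "(4 \<Rightarrow> complex ^ 2) \<Rightarrow> (complex ^ 2) set \<Rightarrow> bool" where
  "lattice_basis b \<Lambda> \<longleftrightarrow> inj b \<and> independent (range b) \<and>
     \<Lambda> = {(\<Sum>i\<in>UNIV. of_int (k i) *\<^sub>R b i) | k :: 4 \<Rightarrow> int. True}"

definition NS :: "(complex ^ 2) set \<Rightarrow> form set" where
  "NS \<Lambda> = {E :: form. (\<forall>x. E x x = 0) \<and> (\<forall>x y. E (\<i> *s x) (\<i> *s y) = E x y) \<and>
     (\<forall>x\<in>\<Lambda>. \<forall>y\<in>\<Lambda>. E x y \<in> \<int>)}"

text \<open>
  Forms that are linearly independent over \<open>\<int>\<close> and integral on \<open>\<Lambda>\<close> are linearly independent over
  \<open>\<real>\<close>, so \<open>NS(X) \<otimes> \<real>\<close> is the real span of \<open>NS(X)\<close>.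
\<close>

definition NS_R :: "(complex ^ 2) set \<Rightarrow> form set" where
  "NS_R \<Lambda> = span (NS \<Lambda>)"

text \<open>
  Ampleness is positivity of the first Chern class, as for Kaehler forms. (Many texts on complex
  tori represent the class by \<open>- E\<close> instead, with the condition \<open>E (\<i> x) x > 0\<close>; this does not
  change intersection numbers on a surface.)
\<close>

definition ample :: "(complex ^ 2) set \<Rightarrow> form set" where
  "ample \<Lambda> = {E :: form. E \<in> NS \<Lambda> \<and> (\<forall>x. x \<noteq> 0 \<longrightarrow> E x (\<i> *s x) > 0)}"

text \<open>An ample real class is a positive real combination of ample integral classes.\<close>

definition ample_R :: "(complex ^ 2) set \<Rightarrow> form set" where
  "ample_R \<Lambda> = {(\<Sum>A\<in>S. c A *\<^sub>R A) | S c.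
     finite S \<and> S \<noteq> {} \<and> S \<subseteq> ample \<Lambda> \<and> (\<forall>A\<in>S. c A > 0)}"

definition abelian_surface :: "(complex ^ 2) set \<Rightarrow> bool" where
  "abelian_surface \<Lambda> \<longleftrightarrow> (\<exists>b. lattice_basis b \<Lambda>) \<and> ample \<Lambda> \<noteq> {}"

text \<open>
  The intersection number is \<open>D \<and> E\<close> evaluated on the fundamental class, which is
  \<open>b 1 \<and> b 2 \<and> b 3 \<and> b 4\<close> for a basis \<open>b\<close> of \<open>\<Lambda>\<close> that is positive for the complex orientation
  \<open>(x\<^sub>1, y\<^sub>1, x\<^sub>2, y\<^sub>2)\<close> of \<open>\<complex>\<^sup>2\<close>. For an arbitrary basis the sign of the determinant corrects the
  orientation; the result is then independent of the basis.
\<close>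

definition wedge :: "form \<Rightarrow> form \<Rightarrow> (4 \<Rightarrow> complex ^ 2) \<Rightarrow> real" where
  "wedge D E b =
     D (b 1) (b 2) * E (b 3) (b 4) - D (b 1) (b 3) * E (b 2) (b 4) + D (b 1) (b 4) * E (b 2) (b 3)
   + D (b 2) (b 3) * E (b 1) (b 4) - D (b 2) (b 4) * E (b 1) (b 3) + D (b 3) (b 4) * E (b 1) (b 2)"

definition real_coords :: "complex ^ 2 \<Rightarrow> real ^ 4" where
  "real_coords z = vector [Re (z $ 1), Im (z $ 1), Re (z $ 2), Im (z $ 2)]"

definition intersect :: "(complex ^ 2) set \<Rightarrow> form \<Rightarrow> form \<Rightarrow> real" where
  "intersect \<Lambda> D E = (let b = (SOME b. lattice_basis b \<Lambda>)
     in sgn (det (\<chi> i. real_coords (b i))) * wedge D E b)"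

text \<open>
  \<open>(x\<^sub>0, x\<^sub>1, x\<^sub>2)\<close> stands for \<open>x\<^sub>0 + x\<^sub>1 + x\<^sub>2 \<rho>\<close>, where \<open>\<rho>\<close> is the fundamental class in \<open>H\<^sup>4(X,\<int>)\<close>.
\<close>

type_synonym mukai_vector = "real \<times> form \<times> real"

definition H_alg :: "(complex ^ 2) set \<Rightarrow> mukai_vector set" where
  "H_alg \<Lambda> = \<int> \<times> NS \<Lambda> \<times> \<int>"

definition H_alg_R :: "(complex ^ 2) set \<Rightarrow> mukai_vector set" where
  "H_alg_R \<Lambda> = UNIV \<times> NS_R \<Lambda> \<times> UNIV"

fun mukai :: "(complex ^ 2) set \<Rightarrow> mukai_vector \<Rightarrow> mukai_vector \<Rightarrow> real" where
  "mukai \<Lambda> (x0, x1, x2) (y0, y1, y2) = intersect \<Lambda> x1 y1 - x0 * y2 - x2 * y0"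

definition mukai_exp :: "(complex ^ 2) set \<Rightarrow> form \<Rightarrow> mukai_vector" where
  "mukai_exp \<Lambda> \<beta> = (1, \<beta>, intersect \<Lambda> \<beta> \<beta> / 2)"

definition amp_closure :: "(complex ^ 2) set \<Rightarrow> form \<Rightarrow> form set" where
  "amp_closure \<Lambda> h = {x \<in> NS_R \<Lambda>. intersect \<Lambda> x x \<ge> 0 \<and> intersect \<Lambda> x h > 0}"

definition norm_on :: "'a::real_vector set \<Rightarrow> ('a \<Rightarrow> real) \<Rightarrow> bool" where
  "norm_on S nrm \<longleftrightarrow> (\<forall>x\<in>S. nrm x \<ge> 0) \<and> (\<forall>x\<in>S. nrm x = 0 \<longleftrightarrow> x = 0) \<and>
     (\<forall>x\<in>S. \<forall>c. nrm (c *\<^sub>R x) = \<bar>c\<bar> * nrm x) \<and> (\<forall>x\<in>S. \<forall>y\<in>S. nrm (x + y) \<le> nrm x + nrm y)"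

definition H_bar :: "(complex ^ 2) set \<Rightarrow> form \<Rightarrow> (form \<Rightarrow> real) \<Rightarrow> (form \<times> form \<times> real) set" where
  "H_bar \<Lambda> h nrm = NS_R \<Lambda> \<times> {x \<in> amp_closure \<Lambda> h. nrm x = 1} \<times> {0..}"

fun P_bar :: "(complex ^ 2) set \<Rightarrow> form \<Rightarrow> mukai_vector \<Rightarrow> mukai_vector set" where
  "P_bar \<Lambda> H0 (r, c1, a) = {x \<in> H_alg_R \<Lambda>. mukai \<Lambda> x (r, c1, a) = 0 \<and> mukai \<Lambda> x x \<ge> 0 \<and>
     mukai \<Lambda> x (0, r *\<^sub>R H0, intersect \<Lambda> H0 c1) > 0}"

definition P_pos :: "(complex ^ 2) set \<Rightarrow> form \<Rightarrow> mukai_vector \<Rightarrow> mukai_vector set" where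
  "P_pos \<Lambda> H0 v = {x \<in> P_bar \<Lambda> H0 v. mukai \<Lambda> x x > 0}"

fun xi :: "(complex ^ 2) set \<Rightarrow> mukai_vector \<Rightarrow> form \<times> form \<times> real \<Rightarrow> mukai_vector" where
  "xi \<Lambda> (r, c1, a) (\<beta>, H, t) =
     (r * (t\<^sup>2 * intersect \<Lambda> H H / 2) + mukai \<Lambda> (mukai_exp \<Lambda> \<beta>) (r, c1, a))
       *\<^sub>R (0, H, intersect \<Lambda> \<beta> H)
     - intersect \<Lambda> (c1 - r *\<^sub>R \<beta>) H
       *\<^sub>R (mukai_exp \<Lambda> \<beta> - (0, 0, t\<^sup>2 * intersect \<Lambda> H H / 2))"

definition ray :: "'a::real_vector \<Rightarrow> 'a set" where
  "ray x = {c *\<^sub>R x | c. c > 0}"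

end

theory Submission imports Defs begin

text \<open>
  Write \<open>d = c\<^sub>1 - r \<beta>\<close>, \<open>s = r t\<^sup>2 (H\<^sup>2) / 2 + \<langle>e\<^sup>\<beta>, v\<rangle>\<close>. Factoring out the isometry \<open>e\<^sup>\<beta>\<close> one finds
  \<open>\<xi> = e\<^sup>\<beta> (- (d,H), s H, (d,H) t\<^sup>2 (H\<^sup>2) / 2)\<close>, and from this
  \<^item> \<open>\<langle>\<xi>, v\<rangle> = 0\<close>,
  \<^item> \<open>\<langle>\<xi>\<^sup>2\<rangle> = (s\<^sup>2 + t\<^sup>2 (d,H)\<^sup>2) (H\<^sup>2)\<close>, which is nonnegative,
  \<^item> \<open>\<langle>\<xi>, r H\<^sub>0 + (H\<^sub>0,c\<^sub>1) \<rho>\<rangle> = r s (H,H\<^sub>0) + (d,H) (d,H\<^sub>0)\<close>,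
  \<^item> \<open>2 r s + (d\<^sup>2) = \<langle>v\<^sup>2\<rangle> + r\<^sup>2 t\<^sup>2 (H\<^sup>2) > 0\<close>.

  By the last two lines the third condition for \<open>\<xi>\<close> to lie in \<open>P_bar\<close> follows from
  \<open>(d\<^sup>2) (H,H\<^sub>0) \<le> 2 (d,H) (d,H\<^sub>0)\<close>. For \<open>(d\<^sup>2) \<noteq> 0\<close> this says that the reflection in \<open>d\<close> maps the
  positive cone to plus or minus itself; in general it is \<open>reflection_inequality\<close>, a consequence of
  the Hodge index theorem. If \<open>t H\<close> is ample, then \<open>\<langle>\<xi>\<^sup>2\<rangle> = 0\<close> would force \<open>(d,H) = 0\<close> and \<open>s = 0\<close>; the
  index theorem would then give \<open>(d\<^sup>2) \<le> 0\<close>, contradicting \<open>2 r s + (d\<^sup>2) > 0\<close>.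

  For surjectivity a preimage of the ray of \<open>x = (x\<^sub>0, x\<^sub>1, x\<^sub>2)\<close> is written down. If \<open>r \<noteq> 0\<close>, orthogonality to
  \<open>v\<close> makes \<open>x\<^sub>2\<close> a function of \<open>x\<^sub>0\<close> and \<open>x\<^sub>1\<close>. The class \<open>z = (x\<^sub>1 - x\<^sub>0 c\<^sub>1 / r) / r\<close> lies in the closed positive
  cone, \<open>H\<close> is its normalisation, and with \<open>t = 0\<close> and \<open>\<beta> = c\<^sub>1 / r + l H\<close> the condition on \<open>l\<close> is a quadratic
  equation (for \<open>(H\<^sup>2) > 0\<close>) whose discriminant is nonnegative exactly because \<open>\<langle>x\<^sup>2\<rangle> \<ge> 0\<close>. If \<open>r = 0\<close>, then \<open>x\<^sub>0 \<noteq> 0\<close>; with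
  \<open>\<beta> = x\<^sub>1 / x\<^sub>0\<close> orthogonality reads \<open>s = 0\<close>, so \<open>H\<close> may be any ample direction and \<open>t\<close> is fixed by \<open>\<langle>x\<^sup>2\<rangle>\<close>.

  It remains to see that the intersection form on real (1,1)-classes satisfies the index theorem. Such
  a class is a Hermitian \<open>2 \<times> 2\<close> matrix, the wedge product is the polarised determinant of these matrices
  (\<open>wedge_eq_det\<close>), and the determinant \<open>a d - \<bar>b\<bar>\<^sup>2\<close> has signature \<open>(1,3)\<close>. Ample classes are positive
  definite matrices.
\<close>

section \<open>Forms with one positive direction\<close>

text \<open>
  The signature is expressed by the reverse Cauchy-Schwarz inequality for a timelike vector: a
  vector of positive square leaves only nonpositive squares in its orthogonal complement. This is
  the form in which the Hodge index theorem is applied.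
\<close>

locale lorentzian_form =
  fixes W :: "'a::real_vector set" and B :: "'a \<Rightarrow> 'a \<Rightarrow> real"
  assumes subspace_W: "subspace W"
    and add_left: "B (x + y) z = B x z + B y z"
    and scaleR_left: "B (c *\<^sub>R x) z = c * B x z"
    and commute: "B x y = B y x"
    and reverse_Cauchy_Schwarz:
      "x \<in> W \<Longrightarrow> y \<in> W \<Longrightarrow> B y y > 0 \<Longrightarrow> B x x * B y y \<le> (B x y)\<^sup>2"
begin

lemma add_right: "B z (x + y) = B z x + B z y"
  using add_left[of x y z] by (simp add: commute)

lemma scaleR_right: "B z (c *\<^sub>R x) = c * B z x"
  using scaleR_left[of c x z] by (simp add: commute)

lemma diff_left: "B (x - y) z = B x z - B y z"
  using add_left[of x "- y" z] scaleR_left[of "-1" y z] by simp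

lemma diff_right: "B z (x - y) = B z x - B z y"
  using diff_left[of x y z] by (simp add: commute)

lemma zero_left: "B 0 z = 0"
  using scaleR_left[of 0 0 z] by simp

lemma zero_right: "B z 0 = 0"
  using zero_left[of z] by (simp add: commute)

lemmas bilinear_simps = add_left add_right diff_left diff_right scaleR_left scaleR_right
  zero_left zero_right

text \<open>
  For \<open>(d\<^sup>2) > 0\<close> the vector \<open>2 (d,x) d / (d\<^sup>2) - x\<close> lies in the same closed cone as \<open>x\<close>, for \<open>(d\<^sup>2) < 0\<close> its
  negative does, and both facts read \<open>(d\<^sup>2) (x,y) \<le> 2 (d,x) (d,y)\<close>. A case distinction is
  avoided by applying the reverse Cauchy-Schwarz inequality to \<open>y\<close> and one combination of \<open>d\<close> and \<open>x\<close>.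
\<close>

lemma reflection_inequality:
  assumes W: "d \<in> W" "x \<in> W" "y \<in> W"
    and x: "B x x \<ge> 0" and y: "B y y > 0" and xy: "B x y > 0"
  shows "B d d * B x y \<le> 2 * B d x * B d y"
proof -
  define m where "m = B x y"
  define q where "q = B d y * m - B d x * B y y"
  \<comment> \<open>The form \<open>(u,y)\<^sup>2 - (u\<^sup>2)(y\<^sup>2)\<close> in \<open>u\<close> is positive semidefinite. Among the vectors
     \<open>m\<^sup>2 d + \<nu> x\<close>, \<open>w\<close> minimises it when \<open>(x\<^sup>2) = 0\<close>, and for \<open>(x\<^sup>2) > 0\<close> the resulting error has the right sign.\<close>
  define w where "w = m\<^sup>2 *\<^sub>R d - q *\<^sub>R x"
  have "w \<in> W"
    unfolding w_def using W by (intro subspace_diff subspace_scale subspace_W)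
  then have "B w w * B y y \<le> (B w y)\<^sup>2"
    using W y by (intro reverse_Cauchy_Schwarz)
  moreover have "(B w y)\<^sup>2 - B w w * B y y
      = m\<^sup>2 * (B y y * (2 * B d x * B d y * m - B d d * m\<^sup>2 - (B d x)\<^sup>2 * B y y)) - q\<^sup>2 * (B x x * B y y)"
    by (simp add: w_def q_def bilinear_simps commute[of x d] m_def power2_eq_square algebra_simps)
  ultimately have "0 \<le> m\<^sup>2 * (B y y * (2 * B d x * B d y * m - B d d * m\<^sup>2 - (B d x)\<^sup>2 * B y y))"
    using x y by (smt (verit) mult_nonneg_nonneg zero_le_power2)
  then have "0 \<le> 2 * B d x * B d y * m - B d d * m\<^sup>2 - (B d x)\<^sup>2 * B y y"
    using y xy by (simp add: m_def zero_le_mult_iff)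
  then have "0 \<le> 2 * B d x * B d y * m - B d d * m\<^sup>2"
    using y by (smt (verit) mult_nonneg_nonneg zero_le_power2)
  then have "0 \<le> m * (2 * B d x * B d y - B d d * m)"
    by (simp add: power2_eq_square algebra_simps)
  then show ?thesis
    using xy by (simp add: m_def zero_le_mult_iff)
qed

text \<open>
  Timelike vectors \<open>y, z\<close> with \<open>(y,z) > 0\<close> select the same half of the light cone. This is what makes the
  closed positive cone independent of the ample class used to define it.
\<close>

lemma same_cone:
  assumes W: "x \<in> W" "y \<in> W" "z \<in> W"
    and x: "B x x \<ge> 0" and "B y y > 0" "B z z > 0" "B y z > 0" "B x y > 0"
  shows "B x z > 0"
proof -
  have "0 < B z z * B x y"
    using assms by simp
  also have "\<dots> \<le> 2 * B z x * B z y"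
    using assms by (intro reflection_inequality) auto
  finally show ?thesis
    using assms by (simp add: commute zero_less_mult_iff)
qed

end

section \<open>Real (1,1)-forms as Hermitian matrices\<close>

lemma det_4:
  "det (A::'a::comm_ring_1^4^4) =
     A$1$1 * (A$2$2 * (A$3$3 * A$4$4 - A$3$4 * A$4$3) - A$2$3 * (A$3$2 * A$4$4 - A$3$4 * A$4$2)
       + A$2$4 * (A$3$2 * A$4$3 - A$3$3 * A$4$2))
   - A$1$2 * (A$2$1 * (A$3$3 * A$4$4 - A$3$4 * A$4$3) - A$2$3 * (A$3$1 * A$4$4 - A$3$4 * A$4$1)
       + A$2$4 * (A$3$1 * A$4$3 - A$3$3 * A$4$1))
   + A$1$3 * (A$2$1 * (A$3$2 * A$4$4 - A$3$4 * A$4$2) - A$2$2 * (A$3$1 * A$4$4 - A$3$4 * A$4$1)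
       + A$2$4 * (A$3$1 * A$4$2 - A$3$2 * A$4$1))
   - A$1$4 * (A$2$1 * (A$3$2 * A$4$3 - A$3$3 * A$4$2) - A$2$2 * (A$3$1 * A$4$3 - A$3$3 * A$4$1)
       + A$2$3 * (A$3$1 * A$4$2 - A$3$2 * A$4$1))"
proof -
  have f1234: "finite {2::4, 3, 4}" "1 \<notin> {2::4, 3, 4}"
    by auto
  have f234: "finite {3::4, 4}" "2 \<notin> {3::4, 4}"
    by auto
  have f34: "finite {4::4}" "3 \<notin> {4::4}"
    by auto
  show ?thesis
    unfolding det_def UNIV_4
    unfolding sum_over_permutations_insert[OF f1234]
    unfolding sum_over_permutations_insert[OF f234]
    unfolding sum_over_permutations_insert[OF f34]
    unfolding permutes_sing
    by (simp add: sign_swap_id permutation_swap_id permutation_compose sign_compose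
        swap_id_eq algebra_simps)
qed

lemma real_coords_nth [simp]:
  "real_coords z $ 1 = Re (z $ 1)" "real_coords z $ 2 = Im (z $ 1)"
  "real_coords z $ 3 = Re (z $ 2)" "real_coords z $ 4 = Im (z $ 2)"
  by (simp_all add: real_coords_def vector_def)

lemma real_coords_sum: "real_coords (\<Sum>i\<in>S. c i *\<^sub>R b i) = (\<Sum>i\<in>S. c i *s real_coords (b i))"
  by (simp add: vec_eq_iff forall_4)

lemma real_coords_eq_0_iff: "real_coords z = 0 \<longleftrightarrow> z = 0"
  by (auto simp: vec_eq_iff forall_4 forall_2 complex_eq_iff)

lemma lattice_basis_det_nonzero:
  assumes "lattice_basis b \<Lambda>"
  shows "det (\<chi> i. real_coords (b i)) \<noteq> 0"
proof -
  have inj: "inj b" and ind: "independent (range b)"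
    using assms by (auto simp: lattice_basis_def)
  have "c i = 0" if "(\<Sum>i\<in>UNIV. c i *s real_coords (b i)) = 0" for c :: "4 \<Rightarrow> real" and i
  proof -
    have "(\<Sum>i\<in>UNIV. c i *\<^sub>R b i) = 0"
      using that by (simp add: real_coords_eq_0_iff flip: real_coords_sum)
    then have "(\<Sum>w\<in>range b. c (inv b w) *\<^sub>R w) = 0"
      using inj by (subst sum.reindex) auto
    then have "c (inv b (b i)) = 0"
      using independentD[OF ind, of "range b" "\<lambda>w. c (inv b w)" "b i"] by auto
    with inj show ?thesis by simp
  qed
  then show ?thesis
    unfolding invertible_det_nz[symmetric] invertible_right_inverse
      matrix_right_invertible_independent_rows
    by (simp add: row_def)
qed

text \<open>
  An alternating form invariant under multiplication by \<open>\<i>\<close> is the imaginary part of the Hermitian form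
  \<open>E(x, \<i> y) + \<i> E(x, y)\<close>. The four real numbers below are the entries of its matrix: the two diagonal
  ones and the real and imaginary part of the one above the diagonal.
\<close>

definition forms_11 :: "form set" where
  "forms_11 = {E :: form. (\<forall>x. E x x = 0) \<and> (\<forall>x y. E (\<i> *s x) (\<i> *s y) = E x y)}"

definition herm11 :: "form \<Rightarrow> real" where "herm11 E = E (axis 1 1) (\<i> *s axis 1 1)"
definition herm22 :: "form \<Rightarrow> real" where "herm22 E = E (axis 2 1) (\<i> *s axis 2 1)"
definition herm12_re :: "form \<Rightarrow> real" where "herm12_re E = E (axis 1 1) (\<i> *s axis 2 1)"
definition herm12_im :: "form \<Rightarrow> real" where "herm12_im E = E (axis 1 1) (axis 2 1)"

lemma forms_11_skew:
  assumes "E \<in> forms_11"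
  shows "E x y = - E y x"
proof -
  have alt: "E z z = 0" for z
    using assms by (simp add: forms_11_def)
  then have "E (x + y) (x + y) = 0" .
  then show ?thesis
    by (simp add: blinfun.bilinear_simps alt)
qed

lemma real_coords_expansion:
  fixes z :: "complex ^ 2"
  shows "z = Re (z $ 1) *\<^sub>R axis 1 1 + Im (z $ 1) *\<^sub>R (\<i> *s axis 1 1)
     + Re (z $ 2) *\<^sub>R axis 2 1 + Im (z $ 2) *\<^sub>R (\<i> *s axis 2 1)"
  by (simp add: vec_eq_iff forall_2 axis_def complex_eq_iff)

lemma forms_11_coords:
  assumes "E \<in> forms_11"
  shows "E x y =
      herm11 E * (Re (x$1) * Im (y$1) - Im (x$1) * Re (y$1))
    + herm22 E * (Re (x$2) * Im (y$2) - Im (x$2) * Re (y$2))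
    + herm12_re E * (Re (x$1) * Im (y$2) - Im (x$2) * Re (y$1) - Im (x$1) * Re (y$2) + Re (x$2) * Im (y$1))
    + herm12_im E * (Re (x$1) * Re (y$2) - Re (x$2) * Re (y$1) + Im (x$1) * Im (y$2) - Im (x$2) * Im (y$1))"
proof -
  define e f :: "complex ^ 2" where "e = axis 1 1" and "f = axis 2 1"
  have alt: "E z z = 0" and inv: "E (\<i> *s z) (\<i> *s w) = E z w" for z w
    using assms by (simp_all add: forms_11_def)
  have skew: "E z w = - E w z" for z w
    using assms by (rule forms_11_skew)
  have ii: "\<i> *s (\<i> *s z) = - z" for z :: "complex ^ 2"
    by (simp add: vec_eq_iff)
  have im: "E (\<i> *s z) w = - E z (\<i> *s w)" for z w
    using inv[of z "\<i> *s w"] by (simp add: ii blinfun.minus_right)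
  have "E x y = E (Re (x$1) *\<^sub>R e + Im (x$1) *\<^sub>R (\<i> *s e) + Re (x$2) *\<^sub>R f + Im (x$2) *\<^sub>R (\<i> *s f))
     (Re (y$1) *\<^sub>R e + Im (y$1) *\<^sub>R (\<i> *s e) + Re (y$2) *\<^sub>R f + Im (y$2) *\<^sub>R (\<i> *s f))"
    unfolding e_def f_def by (simp only: real_coords_expansion[symmetric])
  also have "\<dots> = 
      E e (\<i> *s e) * (Re (x$1) * Im (y$1) - Im (x$1) * Re (y$1))
    + E f (\<i> *s f) * (Re (x$2) * Im (y$2) - Im (x$2) * Re (y$2))
    + E e (\<i> *s f) * (Re (x$1) * Im (y$2) - Im (x$2) * Re (y$1) - Im (x$1) * Re (y$2) + Re (x$2) * Im (y$1))
    + E e f * (Re (x$1) * Re (y$2) - Re (x$2) * Re (y$1) + Im (x$1) * Im (y$2) - Im (x$2) * Im (y$1))"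
    by (simp add: blinfun.bilinear_simps alt inv im skew[of f e] skew[of f "\<i> *s e"] algebra_simps)
  finally show ?thesis
    by (simp add: e_def f_def herm11_def herm22_def herm12_re_def herm12_im_def)
qed

text \<open>
  The polarisation of \<open>E \<mapsto> 2 det E\<close> on Hermitian \<open>2 \<times> 2\<close> matrices.
\<close>

definition herm_det :: "form \<Rightarrow> form \<Rightarrow> real" where
  "herm_det D E = herm11 D * herm22 E + herm22 D * herm11 E
     - 2 * herm12_re D * herm12_re E - 2 * herm12_im D * herm12_im E"

text \<open>
  The wedge of two 2-forms is a 4-form on \<open>\<real>\<^sup>4\<close>, hence its value on \<open>b\<close> is \<open>det b\<close> times its value on the
  standard basis; the latter is \<open>herm_det\<close>. With all coordinates written out both steps
  together are one polynomial identity, a Laplace expansion along two rows.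
\<close>

lemma wedge_eq_det:
  assumes "D \<in> forms_11" "E \<in> forms_11"
  shows "wedge D E b = herm_det D E * det (\<chi> i. real_coords (b i))"
  unfolding wedge_def forms_11_coords[OF assms(1)] forms_11_coords[OF assms(2)]
    det_4 herm_det_def vec_lambda_beta real_coords_nth
  by algebra

text \<open>
  The combination of \<open>D\<close> and \<open>E\<close> whose upper left entry vanishes has nonpositive determinant; this is
  a quadratic inequality in the upper left entries, and eliminating them by completing
  the square leaves the discriminant.
\<close>

lemma reverse_Cauchy_Schwarz_herm_det:
  assumes "herm_det E E > 0"
  shows "herm_det D D * herm_det E E \<le> (herm_det D E)\<^sup>2"
proof -
  let ?a = "herm11 D" and ?a' = "herm11 E"
  have a': "?a' \<noteq> 0"
  proof
    assume "?a' = 0"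
    then have "herm_det E E = - 2 * ((herm12_re E)\<^sup>2 + (herm12_im E)\<^sup>2)"
      by (simp add: herm_det_def power2_eq_square)
    with assms show False
      by (smt (verit) sum_power2_ge_zero)
  qed
  have "?a'\<^sup>2 * herm_det D D - 2 * ?a * ?a' * herm_det D E + ?a\<^sup>2 * herm_det E E
    = - 2 * ((?a' * herm12_re D - ?a * herm12_re E)\<^sup>2 + (?a' * herm12_im D - ?a * herm12_im E)\<^sup>2)"
    unfolding herm_det_def by algebra
  also have "\<dots> \<le> 0"
    by simp
  finally have "herm_det E E * (?a'\<^sup>2 * herm_det D D - 2 * ?a * ?a' * herm_det D E + ?a\<^sup>2 * herm_det E E) \<le> 0"
    using assms by (simp add: mult_le_0_iff)
  moreover have "0 \<le> (?a' * herm_det D E - ?a * herm_det E E)\<^sup>2"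
    by simp
  ultimately have "?a'\<^sup>2 * (herm_det D D * herm_det E E) \<le> ?a'\<^sup>2 * (herm_det D E)\<^sup>2"
    by (simp add: power2_eq_square algebra_simps)
  then show ?thesis
    using a' by simp
qed

text \<open>
  The Kaehler cone of the torus: ample classes are its integral points, and unlike \<open>ample\<close> it does
  not involve the lattice.
\<close>

definition positive_forms :: "form set" where
  "positive_forms = {E \<in> forms_11. \<forall>x :: complex ^ 2. x \<noteq> 0 \<longrightarrow> E x (\<i> *s x) > 0}"

lemma positive_forms_herm:
  assumes "E \<in> positive_forms"
  shows "herm11 E > 0" and "herm22 E > 0"
    and "(herm12_re E)\<^sup>2 + (herm12_im E)\<^sup>2 < herm11 E * herm22 E"
proof -
  have pos: "E x (\<i> *s x) > 0" if "x \<noteq> 0" for x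
    using assms that by (simp add: positive_forms_def)
  have E: "E \<in> forms_11"
    using assms by (simp add: positive_forms_def)
  show "herm11 E > 0" and d: "herm22 E > 0"
    unfolding herm11_def herm22_def by (auto intro: pos)
  \<comment> \<open>Up to scaling, \<open>x\<close> minimises the Hermitian form over vectors with a fixed first coordinate.\<close>
  define x :: "complex ^ 2" where
    "x = vector [of_real (herm22 E), Complex (- herm12_re E) (herm12_im E)]"
  have "x $ 1 \<noteq> 0"
    using d by (simp add: x_def)
  then have "0 < E x (\<i> *s x)"
    by (intro pos) auto
  also have "\<dots> = herm22 E * (herm11 E * herm22 E - ((herm12_re E)\<^sup>2 + (herm12_im E)\<^sup>2))"
    unfolding forms_11_coords[OF E] by (simp add: x_def power2_eq_square algebra_simps)
  finally show "(herm12_re E)\<^sup>2 + (herm12_im E)\<^sup>2 < herm11 E * herm22 E"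
    using d by (simp add: zero_less_mult_iff)
qed

text \<open>
  For positive definite matrices \<open>\<bar>b b'\<bar>\<^sup>2 < (a d) (a' d') \<le> ((a d' + a' d) / 2)\<^sup>2\<close>, by the Cauchy-Schwarz
  and the arithmetic-geometric mean inequality.
\<close>

lemma herm_det_positive_forms:
  assumes "D \<in> positive_forms" "E \<in> positive_forms"
  shows "herm_det D E > 0"
proof -
  note D = positive_forms_herm[OF assms(1)] and E = positive_forms_herm[OF assms(2)]
  let ?s = "herm11 D * herm22 E" and ?t = "herm22 D * herm11 E"
  let ?m = "herm12_re D * herm12_re E + herm12_im D * herm12_im E"
  have "?m\<^sup>2 \<le> ((herm12_re D)\<^sup>2 + (herm12_im D)\<^sup>2) * ((herm12_re E)\<^sup>2 + (herm12_im E)\<^sup>2)"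
    using zero_le_power2[of "herm12_re D * herm12_im E - herm12_im D * herm12_re E"]
    by (simp add: power2_eq_square algebra_simps)
  also have "\<dots> < (herm11 D * herm22 D) * (herm11 E * herm22 E)"
    using D E by (intro mult_strict_mono) (auto intro: add_nonneg_nonneg)
  finally have "(2 * ?m)\<^sup>2 < 4 * ?s * ?t"
    by (simp add: power2_eq_square algebra_simps)
  also have "\<dots> \<le> (?s + ?t)\<^sup>2"
    using zero_le_power2[of "?s - ?t"] by (simp add: power2_eq_square algebra_simps)
  finally have "2 * ?m < ?s + ?t"
    by (rule power2_less_imp_less) (use D E in auto)
  then show ?thesis
    by (simp add: herm_det_def algebra_simps)
qed


section \<open>The intersection form of an abelian surface\<close>

lemma NS_subset_forms_11: "NS \<Lambda> \<subseteq> forms_11"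
  by (auto simp: NS_def forms_11_def)

lemma NS_R_subset_forms_11: "NS_R \<Lambda> \<subseteq> forms_11"
proof -
  have "subspace forms_11"
    by (auto simp: subspace_def forms_11_def blinfun.bilinear_simps)
  then show ?thesis
    unfolding NS_R_def using NS_subset_forms_11 by (rule span_minimal[rotated])
qed

lemma NS_subset_NS_R: "NS \<Lambda> \<subseteq> NS_R \<Lambda>"
  unfolding NS_R_def by (rule span_superset)

lemma subspace_NS_R: "subspace (NS_R \<Lambda>)"
  unfolding NS_R_def by (rule subspace_span)

lemma ample_subset_positive_forms: "ample \<Lambda> \<subseteq> positive_forms"
  using NS_subset_forms_11 by (auto simp: ample_def positive_forms_def)

lemma ample_subset_NS_R: "ample \<Lambda> \<subseteq> NS_R \<Lambda>"
  using NS_subset_NS_R by (auto simp: ample_def)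

lemma ample_R_subset_positive_forms: "ample_R \<Lambda> \<subseteq> positive_forms"
proof
  fix E assume "E \<in> ample_R \<Lambda>"
  then obtain S c where E: "E = (\<Sum>A\<in>S. c A *\<^sub>R A)" and S: "finite S" "S \<noteq> {}" "S \<subseteq> ample \<Lambda>"
    and c: "\<And>A. A \<in> S \<Longrightarrow> c A > 0"
    by (auto simp: ample_R_def)
  have "E \<in> NS_R \<Lambda>"
    unfolding E using S(3) ample_subset_NS_R
    by (intro subspace_sum subspace_scale subspace_NS_R) auto
  moreover have "E x (\<i> *s x) > 0" if "x \<noteq> 0" for x
  proof -
    have "E x (\<i> *s x) = (\<Sum>A\<in>S. c A * A x (\<i> *s x))"
      by (simp add: E blinfun.sum_left blinfun.scaleR_left)
    also have "\<dots> > 0"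
      using S c that by (intro sum_pos) (auto simp: ample_def)
    finally show ?thesis .
  qed
  ultimately show "E \<in> positive_forms"
    using NS_R_subset_forms_11 by (auto simp: positive_forms_def)
qed

locale complex_abelian_surface =
  fixes \<Lambda> :: "(complex ^ 2) set"
  assumes abelian_surface: "abelian_surface \<Lambda>"
begin

text \<open>
  The factor \<open>k\<close> is the covolume of the lattice: the sign in the definition of the
  intersection number turns the determinant of the lattice basis into its absolute value.
\<close>

lemma intersect_eq_herm_det:
  "\<exists>k>0. \<forall>D\<in>forms_11. \<forall>E\<in>forms_11. intersect \<Lambda> D E = k * herm_det D E"
proof -
  define b where "b = (SOME b. lattice_basis b \<Lambda>)"
  have "lattice_basis b \<Lambda>"
    unfolding b_def using abelian_surface
    by (auto simp: abelian_surface_def intro: someI[where P = "\<lambda>b. lattice_basis b \<Lambda>"])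
  then have "det (\<chi> i. real_coords (b i)) \<noteq> 0"
    by (rule lattice_basis_det_nonzero)
  moreover have "intersect \<Lambda> D E = \<bar>det (\<chi> i. real_coords (b i))\<bar> * herm_det D E"
    if "D \<in> forms_11" "E \<in> forms_11" for D E
    using that by (simp add: intersect_def wedge_eq_det flip: b_def) (simp add: sgn_if)
  ultimately show ?thesis
    by (intro exI[of _ "\<bar>det (\<chi> i. real_coords (b i))\<bar>"]) auto
qed

sublocale lorentzian_form "NS_R \<Lambda>" "intersect \<Lambda>"
proof
  show "subspace (NS_R \<Lambda>)"
    by (rule subspace_NS_R)
  show "intersect \<Lambda> (x + y) z = intersect \<Lambda> x z + intersect \<Lambda> y z" for x y z
    by (simp add: intersect_def wedge_def Let_def blinfun.bilinear_simps algebra_simps)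
  show "intersect \<Lambda> (c *\<^sub>R x) z = c * intersect \<Lambda> x z" for c x z
    by (simp add: intersect_def wedge_def Let_def blinfun.bilinear_simps algebra_simps)
  show "intersect \<Lambda> x y = intersect \<Lambda> y x" for x y
    by (simp add: intersect_def wedge_def Let_def algebra_simps)
next
  fix x y assume "x \<in> NS_R \<Lambda>" "y \<in> NS_R \<Lambda>" and pos: "intersect \<Lambda> y y > 0"
  then have xy: "x \<in> forms_11" "y \<in> forms_11"
    using NS_R_subset_forms_11 by auto
  obtain k where k: "k > 0"
    "\<And>D E. D \<in> forms_11 \<Longrightarrow> E \<in> forms_11 \<Longrightarrow> intersect \<Lambda> D E = k * herm_det D E"
    using intersect_eq_herm_det by metis
  have "herm_det y y > 0"
    using pos k(1) by (simp add: k(2) xy zero_less_mult_iff)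
  then have "herm_det x x * herm_det y y \<le> (herm_det x y)\<^sup>2"
    by (rule reverse_Cauchy_Schwarz_herm_det)
  then have "k\<^sup>2 * (herm_det x x * herm_det y y) \<le> k\<^sup>2 * (herm_det x y)\<^sup>2"
    by (rule mult_left_mono) simp
  then show "intersect \<Lambda> x x * intersect \<Lambda> y y \<le> (intersect \<Lambda> x y)\<^sup>2"
    unfolding k(2)[OF xy(1) xy(1)] k(2)[OF xy(1) xy(2)] k(2)[OF xy(2) xy(2)]
    by (simp only: power2_eq_square mult_ac)
qed

lemma intersect_positive_forms:
  assumes "D \<in> positive_forms" "E \<in> positive_forms"
  shows "intersect \<Lambda> D E > 0"
proof -
  obtain k where k: "k > 0"
    "\<And>D E. D \<in> forms_11 \<Longrightarrow> E \<in> forms_11 \<Longrightarrow> intersect \<Lambda> D E = k * herm_det D E"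
    using intersect_eq_herm_det by metis
  have "D \<in> forms_11" "E \<in> forms_11"
    using assms by (auto simp: positive_forms_def)
  with k herm_det_positive_forms[OF assms] show ?thesis
    by simp
qed

lemma amp_closure_intersect_ample:
  assumes "H \<in> amp_closure \<Lambda> h" "h \<in> ample \<Lambda>" "H0 \<in> ample \<Lambda>"
  shows "intersect \<Lambda> H H0 > 0"
proof (rule same_cone)
  show "intersect \<Lambda> h h > 0" "intersect \<Lambda> H0 H0 > 0" "intersect \<Lambda> h H0 > 0"
    using assms ample_subset_positive_forms by (auto intro: intersect_positive_forms)
qed (use assms ample_subset_NS_R in \<open>auto simp: amp_closure_def\<close>)

section \<open>The class \<open>\<xi>(\<beta>, H, t)\<close>\<close>

text \<open>
  The coefficient of \<open>H + (\<beta>,H) \<rho>\<close> in \<open>\<xi>\<close>, called \<open>s\<close> in the introduction.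
\<close>

definition xi_coeff :: "mukai_vector \<Rightarrow> form \<times> form \<times> real \<Rightarrow> real" where
  "xi_coeff v = (\<lambda>(\<beta>, H, t). fst v * (t\<^sup>2 * intersect \<Lambda> H H / 2) + mukai \<Lambda> (mukai_exp \<Lambda> \<beta>) v)"

lemma xi_expand:
  "xi \<Lambda> (r, c1, a) (\<beta>, H, t) =
    (- intersect \<Lambda> (c1 - r *\<^sub>R \<beta>) H,
     xi_coeff (r, c1, a) (\<beta>, H, t) *\<^sub>R H - intersect \<Lambda> (c1 - r *\<^sub>R \<beta>) H *\<^sub>R \<beta>,
     xi_coeff (r, c1, a) (\<beta>, H, t) * intersect \<Lambda> \<beta> H
       - intersect \<Lambda> (c1 - r *\<^sub>R \<beta>) H * (intersect \<Lambda> \<beta> \<beta> / 2 - t\<^sup>2 * intersect \<Lambda> H H / 2))"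
  by (simp add: xi_coeff_def mukai_exp_def)

lemma xi_coeff_expand:
  "xi_coeff (r, c1, a) (\<beta>, H, t) =
     r * (t\<^sup>2 * intersect \<Lambda> H H / 2) + intersect \<Lambda> \<beta> c1 - a - r * intersect \<Lambda> \<beta> \<beta> / 2"
  by (simp add: xi_coeff_def mukai_exp_def)

lemma xi_orthogonal: "mukai \<Lambda> (xi \<Lambda> (r, c1, a) (\<beta>, H, t)) (r, c1, a) = 0"
  unfolding xi_expand xi_coeff_expand mukai.simps
  by (simp add: bilinear_simps commute[of c1 \<beta>] commute[of c1 H] commute[of H \<beta>]
      power2_eq_square field_simps)

lemma xi_square:
  "mukai \<Lambda> (xi \<Lambda> (r, c1, a) (\<beta>, H, t)) (xi \<Lambda> (r, c1, a) (\<beta>, H, t)) =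
     ((xi_coeff (r, c1, a) (\<beta>, H, t))\<^sup>2 + t\<^sup>2 * (intersect \<Lambda> (c1 - r *\<^sub>R \<beta>) H)\<^sup>2) * intersect \<Lambda> H H"
  unfolding xi_expand
  by (simp add: bilinear_simps commute[of H \<beta>] power2_eq_square field_simps)

lemma xi_pairing:
  "mukai \<Lambda> (xi \<Lambda> (r, c1, a) (\<beta>, H, t)) (0, r *\<^sub>R H0, intersect \<Lambda> H0 c1) =
     r * xi_coeff (r, c1, a) (\<beta>, H, t) * intersect \<Lambda> H H0
       + intersect \<Lambda> (c1 - r *\<^sub>R \<beta>) H * intersect \<Lambda> (c1 - r *\<^sub>R \<beta>) H0"
  unfolding xi_expand
  by (simp add: bilinear_simps commute[of H0 c1] power2_eq_square algebra_simps)

text \<open>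
  Since \<open>e\<^sup>\<beta>\<close> is an isometry, \<open>(d\<^sup>2) + 2 r \<langle>e\<^sup>\<beta>, v\<rangle> = \<langle>v\<^sup>2\<rangle>\<close> for \<open>d = c\<^sub>1 - r \<beta>\<close>. This is where \<open>\<langle>v\<^sup>2\<rangle> > 0\<close>
  enters, and it rules out that \<open>s\<close> and \<open>(d,H)\<close> vanish together when \<open>(H\<^sup>2) > 0\<close>.
\<close>

lemma xi_coeff_bound:
  assumes "mukai \<Lambda> (r, c1, a) (r, c1, a) > 0" and "intersect \<Lambda> H H \<ge> 0"
  shows "- intersect \<Lambda> (c1 - r *\<^sub>R \<beta>) (c1 - r *\<^sub>R \<beta>) < 2 * (r * xi_coeff (r, c1, a) (\<beta>, H, t))"
proof -
  have "2 * (r * xi_coeff (r, c1, a) (\<beta>, H, t)) + intersect \<Lambda> (c1 - r *\<^sub>R \<beta>) (c1 - r *\<^sub>R \<beta>)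
      = mukai \<Lambda> (r, c1, a) (r, c1, a) + r\<^sup>2 * t\<^sup>2 * intersect \<Lambda> H H"
    unfolding xi_coeff_expand
    by (simp add: bilinear_simps commute[of \<beta> c1] power2_eq_square field_simps)
  moreover have "r\<^sup>2 * t\<^sup>2 * intersect \<Lambda> H H \<ge> 0"
    using assms(2) by simp
  ultimately show ?thesis
    using assms(1) by linarith
qed

lemma xi_in_H_alg_R:
  assumes "\<beta> \<in> NS_R \<Lambda>" "H \<in> NS_R \<Lambda>"
  shows "xi \<Lambda> (r, c1, a) (\<beta>, H, t) \<in> H_alg_R \<Lambda>"
  unfolding xi_expand H_alg_R_def using assms
  by (auto intro!: subspace_diff subspace_scale subspace_W)

text \<open>
  The third condition is the sum of \<open>xi_coeff_bound\<close>, multiplied by \<open>(H,H\<^sub>0) > 0\<close>, and the reflection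
  inequality for \<open>d\<close>, \<open>H\<close> and \<open>H\<^sub>0\<close>.
\<close>

lemma xi_in_P_bar:
  assumes v: "c1 \<in> NS_R \<Lambda>" "mukai \<Lambda> (r, c1, a) (r, c1, a) > 0"
    and H0: "H0 \<in> ample \<Lambda>" and h: "h \<in> ample \<Lambda>"
    and \<beta>: "\<beta> \<in> NS_R \<Lambda>" and H: "H \<in> amp_closure \<Lambda> h"
  shows "xi \<Lambda> (r, c1, a) (\<beta>, H, t) \<in> P_bar \<Lambda> H0 (r, c1, a)"
proof -
  define d where "d = c1 - r *\<^sub>R \<beta>"
  have W: "d \<in> NS_R \<Lambda>" "H \<in> NS_R \<Lambda>" "H0 \<in> NS_R \<Lambda>"
    using v \<beta> H H0 ample_subset_NS_R
    by (auto simp: d_def amp_closure_def intro!: subspace_diff subspace_scale subspace_W)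
  have HH: "intersect \<Lambda> H H \<ge> 0"
    using H by (simp add: amp_closure_def)
  have HH0: "intersect \<Lambda> H H0 > 0"
    using H h H0 by (rule amp_closure_intersect_ample)
  have "- intersect \<Lambda> d d * intersect \<Lambda> H H0
      < 2 * (r * xi_coeff (r, c1, a) (\<beta>, H, t)) * intersect \<Lambda> H H0"
    unfolding d_def using v HH HH0 by (intro mult_strict_right_mono xi_coeff_bound)
  moreover have "intersect \<Lambda> H0 H0 > 0"
    using H0 ample_subset_positive_forms by (auto intro: intersect_positive_forms)
  then have "intersect \<Lambda> d d * intersect \<Lambda> H H0 \<le> 2 * intersect \<Lambda> d H * intersect \<Lambda> d H0"
    using W HH HH0 by (intro reflection_inequality)
  ultimately have "mukai \<Lambda> (xi \<Lambda> (r, c1, a) (\<beta>, H, t)) (0, r *\<^sub>R H0, intersect \<Lambda> H0 c1) > 0"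
    unfolding xi_pairing d_def by linarith
  moreover have "mukai \<Lambda> (xi \<Lambda> (r, c1, a) (\<beta>, H, t)) (xi \<Lambda> (r, c1, a) (\<beta>, H, t)) \<ge> 0"
    unfolding xi_square using HH by simp
  ultimately show ?thesis
    using xi_orthogonal xi_in_H_alg_R[OF \<beta> W(2)] by (simp del: xi.simps)
qed

text \<open>
  By \<open>xi_square\<close> only \<open>(d,H) = 0\<close> is delicate. There \<open>(d\<^sup>2) \<le> 0\<close> by the index theorem, so
  \<open>xi_coeff_bound\<close> gives \<open>r s > 0\<close>.
\<close>

lemma xi_square_pos:
  assumes v: "c1 \<in> NS_R \<Lambda>" "mukai \<Lambda> (r, c1, a) (r, c1, a) > 0"
    and \<beta>: "\<beta> \<in> NS_R \<Lambda>" and H: "H \<in> NS_R \<Lambda>" "intersect \<Lambda> H H > 0" and t: "t \<noteq> 0"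
  shows "mukai \<Lambda> (xi \<Lambda> (r, c1, a) (\<beta>, H, t)) (xi \<Lambda> (r, c1, a) (\<beta>, H, t)) > 0"
proof (cases "intersect \<Lambda> (c1 - r *\<^sub>R \<beta>) H = 0")
  case False
  then show ?thesis
    unfolding xi_square using H t by (simp add: add_nonneg_pos)
next
  case True
  let ?d = "c1 - r *\<^sub>R \<beta>"
  have "?d \<in> NS_R \<Lambda>"
    using v \<beta> by (intro subspace_diff subspace_scale subspace_W)
  with H True have "intersect \<Lambda> ?d ?d * intersect \<Lambda> H H \<le> 0"
    using reverse_Cauchy_Schwarz[of ?d H] by simp
  with H have "intersect \<Lambda> ?d ?d \<le> 0"
    by (simp add: mult_le_0_iff)
  with xi_coeff_bound[OF v(2), of H \<beta> t] H have "xi_coeff (r, c1, a) (\<beta>, H, t) \<noteq> 0"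
    by auto
  then show ?thesis
    unfolding xi_square using H by (simp add: add_pos_nonneg)
qed

section \<open>Surjectivity\<close>

lemma orthogonal_vectors_eqI:
  assumes "r \<noteq> 0" "mukai \<Lambda> (x0, x1, x2) (r, c1, a) = 0" "mukai \<Lambda> (x0, x1, y2) (r, c1, a) = 0"
  shows "x2 = y2"
  using assms by simp

text \<open>
  For \<open>n > 0\<close> and \<open>\<rho> \<noteq> 0\<close> this is a quadratic equation for \<open>l\<close> with discriminant \<open>n (n - 2 m \<rho>\<^sup>2)\<close>. The
  root of smaller modulus, with the numerator rationalised, also makes sense for \<open>\<rho> = 0\<close>.
\<close>

lemma ex_quadratic_root:
  fixes m n \<rho> :: real
  assumes m: "m > 0" and n: "n \<ge> 0" and le: "2 * m * \<rho>\<^sup>2 \<le> n"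
  obtains l where "l * n = \<rho> * (m + l\<^sup>2 * n / 2)"
proof (cases "n = 0")
  case True
  then have "m * \<rho>\<^sup>2 \<le> 0"
    using le by simp
  then have "\<rho> = 0"
    using m by (simp add: mult_le_0_iff)
  then show ?thesis
    using True that by simp
next
  case False
  define S where "S = sqrt (n * (n - 2 * m * \<rho>\<^sup>2))"
  have S2: "S\<^sup>2 = n * (n - 2 * m * \<rho>\<^sup>2)"
    unfolding S_def using n le by simp
  have q: "n + S > 0"
    unfolding S_def using n le False by (intro add_pos_nonneg) auto
  define l where "l = 2 * m * \<rho> / (n + S)"
  have l: "l * (n + S) = 2 * m * \<rho>"
    using q by (simp add: l_def)
  have "(n + S)\<^sup>2 * (\<rho> * (m + l\<^sup>2 * n / 2)) = \<rho> * (m * (n + S)\<^sup>2 + (l * (n + S))\<^sup>2 * n / 2)"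
    by (simp add: power2_eq_square algebra_simps)
  also have "\<dots> = \<rho> * m * (n\<^sup>2 + 2 * n * S + (S\<^sup>2 + 2 * m * \<rho>\<^sup>2 * n))"
    unfolding l by (simp add: power2_eq_square algebra_simps)
  also have "\<dots> = n * (n + S) * (2 * m * \<rho>)"
    unfolding S2 by (simp add: power2_eq_square algebra_simps)
  also have "\<dots> = (n + S)\<^sup>2 * (l * n)"
    unfolding l[symmetric] by (simp add: power2_eq_square algebra_simps)
  finally show ?thesis
    using q by (intro that[of l]) simp
qed

text \<open>
  After multiplication by the isometry \<open>e\<^sup>\<gamma>\<close> with \<open>\<gamma> = - c\<^sub>1 / r\<close> one may think of \<open>v = (r, 0, - r m)\<close> with \<open>m = \<langle>v\<^sup>2\<rangle> / (2 r\<^sup>2)\<close> and of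
  \<open>x = r (z\<^sub>0, z, m z\<^sub>0)\<close>, so that \<open>\<langle>x\<^sup>2\<rangle> \<ge> 0\<close> means \<open>2 m z\<^sub>0\<^sup>2 \<le> (z\<^sup>2)\<close> and the third condition on \<open>x\<close> means
  \<open>(z,H\<^sub>0) > 0\<close>. For \<open>\<beta> = l H\<close> and \<open>t = 0\<close> one gets \<open>\<xi> = r (l n, g H, l n m)\<close> with \<open>n = (H\<^sup>2)\<close> and
  \<open>g = m + l\<^sup>2 n / 2\<close>, hence \<open>H\<close> has to be proportional to \<open>z\<close> and \<open>l n / g\<close> equal to \<open>z\<^sub>0\<close> divided by the norm
  of \<open>z\<close>.
\<close>

lemma xi_surjective_rank_nonzero:
  assumes v: "c1 \<in> NS_R \<Lambda>" "mukai \<Lambda> (r, c1, a) (r, c1, a) > 0" and r: "r \<noteq> 0"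
    and H0: "H0 \<in> ample \<Lambda>" and h: "h \<in> ample \<Lambda>" and nrm: "norm_on (NS_R \<Lambda>) nrm"
    and x: "x \<in> P_bar \<Lambda> H0 (r, c1, a)"
  shows "\<exists>p\<in>H_bar \<Lambda> h nrm. \<exists>c>0. xi \<Lambda> (r, c1, a) p = c *\<^sub>R x"
proof -
  obtain x0 x1 x2 where x_eq: "x = (x0, x1, x2)"
    by (cases x) auto
  have x1: "x1 \<in> NS_R \<Lambda>" and orth: "mukai \<Lambda> x (r, c1, a) = 0" and sq: "mukai \<Lambda> x x \<ge> 0"
    and pos: "mukai \<Lambda> x (0, r *\<^sub>R H0, intersect \<Lambda> H0 c1) > 0"
    using x by (auto simp: x_eq H_alg_R_def)
  define z where "z = (1 / r) *\<^sub>R (x1 - (x0 / r) *\<^sub>R c1)"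
  have x1_eq: "x1 = r *\<^sub>R z + (x0 / r) *\<^sub>R c1"
    using r by (simp add: z_def)
  have z: "z \<in> NS_R \<Lambda>"
    unfolding z_def using v x1 by (intro subspace_diff subspace_scale subspace_W)
  define m where "m = mukai \<Lambda> (r, c1, a) (r, c1, a) / (2 * r\<^sup>2)"
  have m: "m > 0"
    using v r by (simp add: m_def)
  have x2: "x2 = (intersect \<Lambda> x1 c1 - x0 * a) / r"
    using orth r by (simp add: x_eq field_simps)
  have "mukai \<Lambda> x x = r\<^sup>2 * (intersect \<Lambda> z z - 2 * m * (x0 / r)\<^sup>2)"
    unfolding x_eq x2 m_def using r
    by (simp add: x1_eq bilinear_simps commute[of c1 z] power2_eq_square field_simps)
  then have zz: "2 * m * (x0 / r)\<^sup>2 \<le> intersect \<Lambda> z z"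
    using sq r by (simp add: zero_le_mult_iff)
  have zz0: "intersect \<Lambda> z z \<ge> 0"
    using zz m by (smt (verit) mult_nonneg_nonneg zero_le_power2)
  have "mukai \<Lambda> x (0, r *\<^sub>R H0, intersect \<Lambda> H0 c1) = r\<^sup>2 * intersect \<Lambda> z H0"
    using r by (simp add: x_eq x1_eq bilinear_simps commute[of H0 c1] power2_eq_square field_simps)
  then have zH0: "intersect \<Lambda> z H0 > 0"
    using pos r by (simp add: zero_less_mult_iff)
  have zh: "intersect \<Lambda> z h > 0"
    using amp_closure_intersect_ample[of z H0 h] z zz0 zH0 H0 h by (simp add: amp_closure_def)
  define N where "N = nrm z"
  have "z \<noteq> 0"
    using zh by (auto simp: zero_left)
  then have N: "N > 0"
    using nrm z by (auto simp: N_def norm_on_def less_le)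
  define H where "H = (1 / N) *\<^sub>R z"
  have z_H: "z = N *\<^sub>R H"
    using N by (simp add: H_def)
  have "nrm H = 1"
    using nrm z N \<open>z \<noteq> 0\<close> by (simp add: H_def norm_on_def N_def)
  moreover have H: "H \<in> NS_R \<Lambda>"
    unfolding H_def using z by (intro subspace_scale subspace_W)
  moreover have "intersect \<Lambda> H H \<ge> 0" "intersect \<Lambda> H h > 0"
    using zz0 zh N by (simp_all add: H_def bilinear_simps)
  moreover define n where "n = intersect \<Lambda> H H"
  moreover define \<rho> where "\<rho> = x0 / (r * N)"
  have "2 * m * \<rho>\<^sup>2 \<le> n"
  proof -
    have "2 * m * \<rho>\<^sup>2 = (1 / N\<^sup>2) * (2 * m * (x0 / r)\<^sup>2)"
      by (simp add: \<rho>_def power_divide power_mult_distrib)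
    also have "\<dots> \<le> (1 / N\<^sup>2) * intersect \<Lambda> z z"
      using zz by (intro mult_left_mono) auto
    also have "\<dots> = n"
      by (simp add: n_def H_def bilinear_simps power2_eq_square)
    finally show ?thesis .
  qed
  ultimately obtain l where l: "l * n = \<rho> * (m + l\<^sup>2 * n / 2)"
    using ex_quadratic_root[OF m] by blast
  define \<beta> where "\<beta> = (1 / r) *\<^sub>R c1 + l *\<^sub>R H"
  have \<beta>: "\<beta> \<in> NS_R \<Lambda>"
    unfolding \<beta>_def using v H by (intro subspace_add subspace_scale subspace_W)
  define g where "g = m + l\<^sup>2 * n / 2"
  have g: "g > 0"
    unfolding g_def using m \<open>intersect \<Lambda> H H \<ge> 0\<close> by (simp add: n_def add_pos_nonneg)
  have d: "c1 - r *\<^sub>R \<beta> = - (r * l) *\<^sub>R H"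
    using r by (simp add: \<beta>_def algebra_simps)
  have dH: "intersect \<Lambda> (c1 - r *\<^sub>R \<beta>) H = - (r * l * n)"
    unfolding d scaleR_left n_def by simp
  have s: "xi_coeff (r, c1, a) (\<beta>, H, 0) = r * (m - l\<^sup>2 * n / 2)"
    unfolding xi_coeff_expand m_def n_def \<beta>_def using r
    by (simp add: bilinear_simps commute[of H c1] power2_eq_square field_simps)
  obtain y2 where y: "xi \<Lambda> (r, c1, a) (\<beta>, H, 0)
      = (r * l * n, (r * (m - l\<^sup>2 * n / 2)) *\<^sub>R H + (r * l * n) *\<^sub>R \<beta>, y2)"
    unfolding xi_expand dH s by simp
  have c0: "r * l * n = (g / N) * x0"
    using l r N by (simp add: g_def \<rho>_def field_simps)
  have "(r * (m - l\<^sup>2 * n / 2)) *\<^sub>R H + (r * l * n) *\<^sub>R \<beta> = (r * g) *\<^sub>R H + (l * n) *\<^sub>R c1"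
  proof -
    have "(r * l * n) *\<^sub>R \<beta> = (l * n) *\<^sub>R c1 + (r * l\<^sup>2 * n) *\<^sub>R H"
      using r by (simp add: \<beta>_def scaleR_add_right power2_eq_square mult_ac)
    moreover have "r * g = r * (m - l\<^sup>2 * n / 2) + r * l\<^sup>2 * n"
      by (simp add: g_def algebra_simps)
    ultimately show ?thesis
      by (simp only: scaleR_add_left add_ac)
  qed
  also have "\<dots> = (g / N) *\<^sub>R x1"
  proof -
    have "l * n = (r * l * n) / r"
      using r by simp
    also have "\<dots> = (g / N) * (x0 / r)"
      unfolding c0 by simp
    finally show ?thesis
      using N by (simp add: x1_eq z_H scaleR_add_right mult.commute)
  qed
  finally have c1': "(r * (m - l\<^sup>2 * n / 2)) *\<^sub>R H + (r * l * n) *\<^sub>R \<beta> = (g / N) *\<^sub>R x1" .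
  have y_eq: "xi \<Lambda> (r, c1, a) (\<beta>, H, 0) = ((g / N) * x0, (g / N) *\<^sub>R x1, y2)"
    unfolding y unfolding c1' unfolding c0 ..
  have "mukai \<Lambda> ((g / N) * x0, (g / N) *\<^sub>R x1, y2) (r, c1, a) = 0"
    using xi_orthogonal[of r c1 a \<beta> H 0] unfolding y_eq .
  moreover have "mukai \<Lambda> ((g / N) * x0, (g / N) *\<^sub>R x1, (g / N) * x2) (r, c1, a)
      = (g / N) * mukai \<Lambda> x (r, c1, a)"
    by (simp add: x_eq scaleR_left right_diff_distrib)
  then have "mukai \<Lambda> ((g / N) * x0, (g / N) *\<^sub>R x1, (g / N) * x2) (r, c1, a) = 0"
    unfolding orth by simp
  ultimately have "y2 = (g / N) * x2"
    by (rule orthogonal_vectors_eqI[OF r])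
  then have "xi \<Lambda> (r, c1, a) (\<beta>, H, 0) = (g / N) *\<^sub>R x"
    unfolding y_eq by (simp add: x_eq)
  moreover have "(\<beta>, H, 0) \<in> H_bar \<Lambda> h nrm"
    using \<beta> H \<open>nrm H = 1\<close> \<open>intersect \<Lambda> H H \<ge> 0\<close> \<open>intersect \<Lambda> H h > 0\<close>
    by (simp add: H_bar_def amp_closure_def)
  ultimately show ?thesis
    using g N by (intro bexI[of _ "(\<beta>, H, 0)"] exI[of _ "g / N"]) auto
qed

text \<open>
  Here \<open>\<xi>\<close> is \<open>- (c\<^sub>1,H) (e\<^sup>\<beta> - t\<^sup>2 (H\<^sup>2) \<rho> / 2)\<close> as soon as \<open>s = 0\<close>, and \<open>s = \<langle>e\<^sup>\<beta>, v\<rangle>\<close> vanishes for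
  \<open>\<beta> = x\<^sub>1 / x\<^sub>0\<close> because \<open>x\<close> is orthogonal to \<open>v\<close>. The factor \<open>- (c\<^sub>1,H) / x\<^sub>0\<close> is positive: \<open>(c\<^sub>1,H)\<close> has
  the sign of \<open>(c\<^sub>1,H\<^sub>0)\<close>, which is opposite to the sign of \<open>x\<^sub>0\<close>.
\<close>

lemma xi_surjective_rank_zero:
  assumes v: "c1 \<in> NS_R \<Lambda>" "mukai \<Lambda> (0, c1, a) (0, c1, a) > 0"
    and H0: "H0 \<in> ample \<Lambda>" and h: "h \<in> ample \<Lambda>" and nrm: "norm_on (NS_R \<Lambda>) nrm"
    and x: "x \<in> P_bar \<Lambda> H0 (0, c1, a)"
  shows "\<exists>p\<in>H_bar \<Lambda> h nrm. \<exists>c>0. xi \<Lambda> (0, c1, a) p = c *\<^sub>R x"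
proof -
  obtain x0 x1 x2 where x_eq: "x = (x0, x1, x2)"
    by (cases x) auto
  have x1: "x1 \<in> NS_R \<Lambda>" and orth: "intersect \<Lambda> x1 c1 = x0 * a"
    and sq: "intersect \<Lambda> x1 x1 - 2 * x0 * x2 \<ge> 0"
    and pos: "x0 * intersect \<Lambda> H0 c1 < 0"
    using x by (auto simp: x_eq H_alg_R_def zero_right)
  have c1: "intersect \<Lambda> c1 c1 > 0"
    using v by simp
  have hh: "intersect \<Lambda> h h > 0" "intersect \<Lambda> h H0 > 0" "h \<in> NS_R \<Lambda>" "H0 \<in> NS_R \<Lambda>"
    "intersect \<Lambda> H0 H0 > 0"
    using h H0 ample_subset_positive_forms ample_subset_NS_R
    by (auto intro!: intersect_positive_forms)
  define N where "N = nrm h"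
  have "h \<noteq> 0"
    using hh by (auto simp: zero_left)
  then have N: "N > 0"
    using nrm hh by (auto simp: N_def norm_on_def less_le)
  define H where "H = (1 / N) *\<^sub>R h"
  have HH: "intersect \<Lambda> H H > 0" "intersect \<Lambda> H h > 0" "intersect \<Lambda> H H0 > 0"
    using hh N by (simp_all add: H_def bilinear_simps)
  have H: "H \<in> NS_R \<Lambda>" "nrm H = 1"
    using hh N nrm by (auto simp: H_def norm_on_def N_def intro: subspace_scale subspace_W)
  have x0: "x0 \<noteq> 0"
    using pos by auto
  define \<beta> where "\<beta> = (1 / x0) *\<^sub>R x1"
  have \<beta>: "\<beta> \<in> NS_R \<Lambda>"
    unfolding \<beta>_def using x1 by (intro subspace_scale subspace_W)
  \<comment> \<open>chosen such that \<open>(\<beta>\<^sup>2) - t\<^sup>2 (H\<^sup>2) = 2 x\<^sub>2 / x\<^sub>0\<close>\<close>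
  define t where "t = sqrt ((intersect \<Lambda> x1 x1 - 2 * x0 * x2) / (x0\<^sup>2 * intersect \<Lambda> H H))"
  have t: "t \<ge> 0" and t2: "t\<^sup>2 * intersect \<Lambda> H H = (intersect \<Lambda> x1 x1 - 2 * x0 * x2) / x0\<^sup>2"
    unfolding t_def using sq HH by simp_all
  \<comment> \<open>\<open>(c\<^sub>1\<^sup>2) > 0\<close>, so \<open>c\<^sub>1\<close> pairs with all classes of the positive cone with the same sign.\<close>
  have "0 < intersect \<Lambda> c1 c1 * intersect \<Lambda> H H0"
    using c1 HH by simp
  also have "\<dots> \<le> 2 * intersect \<Lambda> c1 H * intersect \<Lambda> c1 H0"
    using v H hh HH by (intro reflection_inequality) auto
  finally have "0 < 2 * intersect \<Lambda> c1 H * intersect \<Lambda> c1 H0" .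
  have c: "- intersect \<Lambda> c1 H / x0 > 0"
  proof (cases "x0 > 0")
    case True
    with pos have "intersect \<Lambda> c1 H0 < 0"
      by (simp add: mult_less_0_iff commute[of H0 c1])
    with \<open>0 < 2 * intersect \<Lambda> c1 H * intersect \<Lambda> c1 H0\<close> True show ?thesis
      by (simp add: zero_less_mult_iff divide_neg_pos)
  next
    case False
    with pos have "x0 < 0" "intersect \<Lambda> c1 H0 > 0"
      by (auto simp: mult_less_0_iff commute[of H0 c1])
    with \<open>0 < 2 * intersect \<Lambda> c1 H * intersect \<Lambda> c1 H0\<close> show ?thesis
      by (simp add: zero_less_mult_iff divide_pos_neg)
  qed
  have "xi_coeff (0, c1, a) (\<beta>, H, t) = 0"
    unfolding xi_coeff_expand using orth x0 by (simp add: \<beta>_def scaleR_left)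
  moreover have "intersect \<Lambda> \<beta> \<beta> / 2 - t\<^sup>2 * intersect \<Lambda> H H / 2 = x2 / x0"
    unfolding t2 \<beta>_def using x0 by (simp add: bilinear_simps power2_eq_square field_simps)
  ultimately have "xi \<Lambda> (0, c1, a) (\<beta>, H, t) = (- intersect \<Lambda> c1 H / x0) *\<^sub>R x"
    unfolding xi_expand using x0 by (simp add: x_eq \<beta>_def)
  moreover have "(\<beta>, H, t) \<in> H_bar \<Lambda> h nrm"
    using \<beta> H HH t by (simp add: H_bar_def amp_closure_def)
  ultimately show ?thesis
    using c by blast
qed

end

lemma ray_scaleR:
  assumes "c > 0"
  shows "ray (c *\<^sub>R x) = ray x"
proof -
  have "a *\<^sub>R x \<in> ray (c *\<^sub>R x)" if "a > 0" for a
    unfolding ray_def mem_Collect_eq using assms that by (intro exI[of _ "a / c"]) simp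
  moreover have "a *\<^sub>R c *\<^sub>R x \<in> ray x" if "a > 0" for a
    unfolding ray_def mem_Collect_eq using assms that by (intro exI[of _ "a * c"]) simp
  ultimately show ?thesis
    unfolding ray_def[of x] ray_def[of "c *\<^sub>R x"] by blast
qed

theorem proposition1p1:
  fixes \<Lambda> :: "(complex ^ 2) set" and v :: mukai_vector and H0 h :: form and nrm :: "form \<Rightarrow> real"
  assumes "abelian_surface \<Lambda>"
    and "v \<in> H_alg \<Lambda>" and "mukai \<Lambda> v v > 0"
    and "H0 \<in> ample \<Lambda>" and "h \<in> ample \<Lambda>"
    and "norm_on (NS_R \<Lambda>) nrm"
  shows "(\<forall>p \<in> H_bar \<Lambda> h nrm. xi \<Lambda> v p \<in> P_bar \<Lambda> H0 v)
    \<and> (\<lambda>p. ray (xi \<Lambda> v p)) ` H_bar \<Lambda> h nrm = ray ` P_bar \<Lambda> H0 v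
    \<and> (\<forall>(\<beta>, H, t) \<in> H_bar \<Lambda> h nrm.
          t *\<^sub>R H \<in> ample_R \<Lambda> \<longrightarrow> xi \<Lambda> v (\<beta>, H, t) \<in> P_pos \<Lambda> H0 v)"
proof -
  interpret complex_abelian_surface \<Lambda>
    using assms(1) by unfold_locales
  obtain r c1 a where v: "v = (r, c1, a)"
    by (cases v) auto
  have c1: "c1 \<in> NS_R \<Lambda>"
    using assms(2) NS_subset_NS_R by (auto simp: v H_alg_def)
  have vv: "mukai \<Lambda> (r, c1, a) (r, c1, a) > 0"
    using assms(3) unfolding v .
  have mem: "xi \<Lambda> v p \<in> P_bar \<Lambda> H0 v" if "p \<in> H_bar \<Lambda> h nrm" for p
  proof -
    obtain \<beta> H t where p: "p = (\<beta>, H, t)"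
      by (cases p) auto
    show ?thesis
      unfolding p v using that by (intro xi_in_P_bar[OF c1 vv assms(4,5)]) (auto simp: p H_bar_def)
  qed
  have surj: "\<exists>p\<in>H_bar \<Lambda> h nrm. \<exists>c>0. xi \<Lambda> v p = c *\<^sub>R x" if "x \<in> P_bar \<Lambda> H0 v" for x
  proof (cases "r = 0")
    case True
    with xi_surjective_rank_zero[OF c1 _ assms(4-6)] vv that show ?thesis
      unfolding v True by blast
  next
    case False
    with xi_surjective_rank_nonzero[OF c1 vv _ assms(4-6)] that show ?thesis
      unfolding v by blast
  qed
  have "(\<lambda>p. ray (xi \<Lambda> v p)) ` H_bar \<Lambda> h nrm = ray ` P_bar \<Lambda> H0 v"
  proof
    show "(\<lambda>p. ray (xi \<Lambda> v p)) ` H_bar \<Lambda> h nrm \<subseteq> ray ` P_bar \<Lambda> H0 v"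
      using mem by auto
    show "ray ` P_bar \<Lambda> H0 v \<subseteq> (\<lambda>p. ray (xi \<Lambda> v p)) ` H_bar \<Lambda> h nrm"
    proof
      fix R assume "R \<in> ray ` P_bar \<Lambda> H0 v"
      then obtain x where R: "R = ray x" and "x \<in> P_bar \<Lambda> H0 v"
        by blast
      with surj obtain p c where p: "p \<in> H_bar \<Lambda> h nrm" and "c > 0" "xi \<Lambda> v p = c *\<^sub>R x"
        by blast
      then have "R = ray (xi \<Lambda> v p)"
        by (simp add: R ray_scaleR)
      with p show "R \<in> (\<lambda>p. ray (xi \<Lambda> v p)) ` H_bar \<Lambda> h nrm"
        by blast
    qed
  qed
  moreover have "xi \<Lambda> v (\<beta>, H, t) \<in> P_pos \<Lambda> H0 v"
    if p: "(\<beta>, H, t) \<in> H_bar \<Lambda> h nrm" and ample: "t *\<^sub>R H \<in> ample_R \<Lambda>" for \<beta> H t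
  proof -
    have "intersect \<Lambda> (t *\<^sub>R H) (t *\<^sub>R H) > 0"
      using ample ample_R_subset_positive_forms by (intro intersect_positive_forms) auto
    then have "t\<^sup>2 * intersect \<Lambda> H H > 0"
      by (simp add: bilinear_simps power2_eq_square)
    then have tH: "t \<noteq> 0" "intersect \<Lambda> H H > 0"
      by (auto simp: zero_less_mult_iff)
    have "\<beta> \<in> NS_R \<Lambda>" "H \<in> NS_R \<Lambda>"
      using p by (auto simp: H_bar_def amp_closure_def)
    from xi_square_pos[OF c1 vv this tH(2,1)] mem[OF p] show ?thesis
      unfolding P_pos_def v by blast
  qed
  ultimately show ?thesis
    using mem by (auto simp del: xi.simps P_bar.simps)
qed

end
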